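(* Let $X$ be a Banach space with the alternative Daugavet property. Then every $T\in\operatorname{Lip}(X)$ for which $\operatorname{slope}(T)$ is an SCD set satisfies the alternative Daugavet equation $\max_{\theta\in\mathbb{T}}\|\mathrm{Id}+\theta T\|=1+\|T\|$.
   Context: $X$ is a Banach space over $\mathbb{K}=\mathbb{R}$ or $\mathbb{C}$, and $\mathbb{T}=\{\theta\in\mathbb{K}:|\theta|=1\}$. $X$ has the alternative Daugavet property if every rank-one bounded linear operator $R:X\to X$ satisfies $\max_{\theta\in\mathbb{T}}\|\mathrm{Id}+\theta R\|=1+\|R\|$. $\operatorname{Lip}(X)$ is the space of Lipschitz maps $T:X\to X$ (not necessarily linear) with the seminorm $\|T\|=\sup\left\{\frac{\|T(x_1)-T(x_2)\|}{\|x_1-x_2\|}:x_1\neq x_2\in X\right\}$ (formally modulo constants, or with $T(0)=0$); for linear operators this is the operator norm. $\operatorname{slope}(T):=\left\{\frac{T(x_1)-T(x_2)}{\|x_1-x_2\|}:x_1\neq x_2\in X\right\}$. A slice of a set $A\subset X$ is a non-empty set of the form $\{x\in A:\operatorname{Re}x^*(x)>\alpha\}$ with $x^*\in X^*\setminus\{0\}$, $\alpha\in\mathbb{R}$. A bounded set $A\subset X$ (not necessarily convex) is an SCD (slicely countably determined) set if there is a sequence $\{S_n:n\in\mathbb{N}\}$ of slices of $A$ which is determining, i.e. $A\subset\overline{\operatorname{conv}}(B)$ whenever $B\subset A$ intersects every $S_n$. *)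

theory Defs
  imports "HOL-Analysis.Analysis"
begin

text \<open>
  The scalar field is the type \<open>'k\<close>, used below at \<open>real\<close> and at \<open>complex\<close>. As the class
  \<open>banach\<close> only provides real scalars, the multiplication by scalars in \<open>'k\<close> is an explicit
  argument \<open>smul\<close>. At \<open>'k = real\<close> it is \<open>scaleR\<close>; a complex Banach space is a type of
  class \<open>banach\<close> with a \<open>smul\<close> satisfying the following locale at \<open>'k = complex\<close>.
\<close>

locale normed_space_over = vector_space smul
  for smul :: "'k::real_normed_field \<Rightarrow> 'a::real_normed_vector \<Rightarrow> 'a" +
  assumes smul_of_real: "smul (of_real r) x = r *\<^sub>R x"
    and norm_smul: "norm (smul c x) = norm c * norm x"

lemma normed_space_over_scaleR:
  "normed_space_over (scaleR :: real \<Rightarrow> 'a::real_normed_vector \<Rightarrow> 'a)"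
  by unfold_locales (auto simp: algebra_simps)

definition bounded_operators ::
    "('k::real_normed_field \<Rightarrow> 'a::real_normed_vector \<Rightarrow> 'a) \<Rightarrow> ('a \<Rightarrow> 'a) set" where
  "bounded_operators smul = {R. bounded_linear R \<and> (\<forall>c x. R (smul c x) = smul c (R x))}"

definition dual_space ::
    "('k::real_normed_field \<Rightarrow> 'a::real_normed_vector \<Rightarrow> 'a) \<Rightarrow> ('a \<Rightarrow> 'k) set" where
  "dual_space smul = {f. bounded_linear f \<and> (\<forall>c x. f (smul c x) = c * f x)}"

definition rank_one ::
    "('k::real_normed_field \<Rightarrow> 'a::real_normed_vector \<Rightarrow> 'a) \<Rightarrow> ('a \<Rightarrow> 'a) \<Rightarrow> bool" where
  "rank_one smul R \<longleftrightarrow> (\<exists>y. y \<noteq> 0 \<and> range R = range (\<lambda>c. smul c y))"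

definition is_max :: "real set \<Rightarrow> real \<Rightarrow> bool" where
  "is_max A m \<longleftrightarrow> m \<in> A \<and> (\<forall>a\<in>A. a \<le> m)"

definition alternative_Daugavet_property ::
    "('k::real_normed_field \<Rightarrow> 'a::real_normed_vector \<Rightarrow> 'a) \<Rightarrow> bool" where
  "alternative_Daugavet_property smul \<longleftrightarrow>
     (\<forall>R \<in> bounded_operators smul. rank_one smul R \<longrightarrow>
        is_max {onorm (\<lambda>x. x + smul \<theta> (R x)) |\<theta>. norm \<theta> = 1} (1 + onorm R))"

definition Lip :: "('a::real_normed_vector \<Rightarrow> 'a) set" where
  "Lip = {T. \<exists>L. L-lipschitz_on UNIV T}"

definition lip_norm :: "('a::real_normed_vector \<Rightarrow> 'a) \<Rightarrow> real" where
  "lip_norm T = Sup {norm (T x1 - T x2) / norm (x1 - x2) |x1 x2. x1 \<noteq> x2}"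

definition slope :: "('a::real_normed_vector \<Rightarrow> 'a) \<Rightarrow> 'a set" where
  "slope T = {(T x1 - T x2) /\<^sub>R norm (x1 - x2) |x1 x2. x1 \<noteq> x2}"

definition alternative_Daugavet_equation ::
    "('k::real_normed_field \<Rightarrow> 'a::real_normed_vector \<Rightarrow> 'a) \<Rightarrow> ('a \<Rightarrow> 'a) \<Rightarrow> bool" where
  "alternative_Daugavet_equation smul T \<longleftrightarrow>
     is_max {lip_norm (\<lambda>x. x + smul \<theta> (T x)) |\<theta>. norm \<theta> = 1} (1 + lip_norm T)"

text \<open>The real part of a scalar \<open>z\<close> is written \<open>z \<bullet> 1\<close>, which makes sense for both fields.\<close>

lemma inner_one_real: "(z::real) \<bullet> 1 = z"
  by simp

lemma inner_one_complex: "(z::complex) \<bullet> 1 = Re z"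
  by (simp add: inner_complex_def)

definition is_slice ::
    "('k::{real_normed_field,real_inner} \<Rightarrow> 'a::real_normed_vector \<Rightarrow> 'a)
      \<Rightarrow> 'a set \<Rightarrow> 'a set \<Rightarrow> bool" where
  "is_slice smul A S \<longleftrightarrow> S \<noteq> {} \<and>
     (\<exists>f \<in> dual_space smul. \<exists>\<alpha>. f \<noteq> (\<lambda>_. 0) \<and> S = {x \<in> A. f x \<bullet> 1 > \<alpha>})"

definition SCD_set ::
    "('k::{real_normed_field,real_inner} \<Rightarrow> 'a::real_normed_vector \<Rightarrow> 'a) \<Rightarrow> 'a set \<Rightarrow> bool" where
  "SCD_set smul A \<longleftrightarrow> bounded A \<and>
     (\<exists>S :: nat \<Rightarrow> 'a set. (\<forall>n. is_slice smul A (S n)) \<and>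
        (\<forall>B \<subseteq> A. (\<forall>n. B \<inter> S n \<noteq> {}) \<longrightarrow> A \<subseteq> closure (convex hull B)))"

end

theory Submission
  imports Defs
begin

text \<open>
  Let \<open>s\<close> be a slope of \<open>T\<close> of nearly maximal norm, and let \<open>S\<^sub>n\<close> be a determining sequence
  of slices of the slopes. The alternative Daugavet property gives, one after the other, pairs of
  points with slope \<open>v\<^sub>n\<close> in \<open>S\<^sub>n\<close> whose directions, rotated by scalars of modulus one to
  \<open>w\<^sub>n\<close>, are almost aligned with \<open>s\<close> and with all earlier ones, in the sense that every
  partial sum of \<open>s / \<parallel>s\<parallel>, w\<^sub>0, w\<^sub>1, \<dots>\<close> has almost maximal norm. Since \<open>s\<close> lies in the closed
  convex hull of the \<open>v\<^sub>n\<close>, it is close to some \<open>\<Sum> c\<^sub>n v\<^sub>n\<close>, hence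
  \<open>\<Sum> c\<^sub>n \<parallel>w\<^sub>n + v\<^sub>n\<parallel> \<ge> \<parallel>\<Sum> c\<^sub>n w\<^sub>n + s\<parallel> - \<epsilon>\<close> is almost \<open>1 + \<parallel>s\<parallel>\<close>, and so is one of the
  norms on the left.

  The directional step is a Hahn-Banach argument: for a real Lipschitz function \<open>g\<close>, the supremum
  of the slopes of \<open>g\<close> in direction \<open>x\<close> is a sublinear function of \<open>x\<close>, so the nonlinear slice of
  directions in which \<open>g\<close> has a large slope contains a linear slice of the sphere.
\<close>

section \<open>Hahn-Banach for sublinear functions\<close>

text \<open>Only \<open>\<le>\<close> and only positive t are asked, so that infima and suprema are
  checked from one side; equality and the value 0 at 0 follow.\<close>

definition sublinear :: "('a::real_vector \<Rightarrow> real) \<Rightarrow> bool" where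
  "sublinear p \<longleftrightarrow> (\<forall>x y. p (x + y) \<le> p x + p y) \<and> (\<forall>t x. 0 < t \<longrightarrow> p (t *\<^sub>R x) \<le> t * p x)"

lemma sublinearI:
  assumes "\<And>x y. p (x + y) \<le> p x + p y" and "\<And>t x. 0 < t \<Longrightarrow> p (t *\<^sub>R x) \<le> t * p x"
  shows "sublinear p"
  using assms by (simp add: sublinear_def)

lemma sublinear_add: "sublinear p \<Longrightarrow> p (x + y) \<le> p x + p y"
  by (simp add: sublinear_def)

lemma sublinear_scale_le: "sublinear p \<Longrightarrow> 0 < t \<Longrightarrow> p (t *\<^sub>R x) \<le> t * p x"
  by (simp add: sublinear_def)

lemma sublinear_zero: "sublinear p \<Longrightarrow> p 0 = 0"
  \<comment> \<open>The factor 2 gives \<open>0 \<le> p 0\<close>, the factor 1/2 gives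
    \<open>p 0 \<le> 0\<close>.\<close>
  using sublinear_scale_le[of p 2 0] sublinear_scale_le[of p "1/2" 0] by simp

lemma sublinear_scale:
  assumes "sublinear p" "0 \<le> t"
  shows "p (t *\<^sub>R x) = t * p x"
proof (cases "t = 0")
  case False
  with assms have t: "0 < t" by simp
  have "p (inverse t *\<^sub>R (t *\<^sub>R x)) \<le> inverse t * p (t *\<^sub>R x)"
    using assms(1) t by (intro sublinear_scale_le) auto
  with t have "t * p x \<le> p (t *\<^sub>R x)" by (simp add: field_simps)
  with sublinear_scale_le[OF assms(1) t, of x] show ?thesis by simp
qed (simp add: assms sublinear_zero)

lemma sublinear_minus: "sublinear p \<Longrightarrow> - p (- x) \<le> p x"
  using sublinear_add[of p x "- x"] by (simp add: sublinear_zero)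

text \<open>The tilt is the infimum of p over the half-line from x in direction y, corrected by p y
  per unit. For a minimal p the last bound becomes superadditivity.\<close>

lemma sublinear_tilt:
  assumes p: "sublinear p"
  obtains q where "sublinear q" "\<And>x. q x \<le> p x" "\<And>x. q x \<le> p (x + y) - p y"
proof -
  define q where "q x = (INF t\<in>{0..}. p (x + t *\<^sub>R y) - t * p y)" for x
  \<comment> \<open>The infimum is finite, as \<open>t * p y = p (t *\<^sub>R y)\<close> is at most
    the sum of the values of p at x + t y and at - x.\<close>
  have lower: "- p (- x) \<le> p (x + t *\<^sub>R y) - t * p y" if "0 \<le> t" for x t
    using sublinear_add[OF p, of "x + t *\<^sub>R y" "- x"] sublinear_scale[OF p that, of y] by simp
  have q_le: "q x \<le> p (x + t *\<^sub>R y) - t * p y" if "0 \<le> t" for x t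
    unfolding q_def using that lower by (intro cINF_lower bdd_belowI2) auto
  have q_ge: "b \<le> q x" if "\<And>t. 0 \<le> t \<Longrightarrow> b \<le> p (x + t *\<^sub>R y) - t * p y" for b x
    unfolding q_def using that by (intro cINF_greatest) auto
  have "sublinear q"
  proof (rule sublinearI)
    fix x x'
    \<comment> \<open>Parameters s for x and t for x' combine to the admissible parameter s + t for
      x + x'; the two infima are then taken one after the other.\<close>
    have *: "q (x + x') \<le> (p (x + s *\<^sub>R y) - s * p y) + (p (x' + t *\<^sub>R y) - t * p y)"
      if "0 \<le> s" "0 \<le> t" for s t
      using q_le[of "s + t" "x + x'"] sublinear_add[OF p, of "x + s *\<^sub>R y" "x' + t *\<^sub>R y"] that
      by (simp add: algebra_simps)
    have "q (x + x') - (p (x + s *\<^sub>R y) - s * p y) \<le> q x'" if "0 \<le> s" for s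
      by (rule q_ge) (use * that in fastforce)
    then have "q (x + x') - q x' \<le> q x"
      by (intro q_ge) fastforce
    then show "q (x + x') \<le> q x + q x'" by simp
  next
    fix r :: real and x assume r: "0 < r"
    have "q (r *\<^sub>R x) / r \<le> q x"
    proof (rule q_ge)
      fix t :: real assume t: "0 \<le> t"
      have "q (r *\<^sub>R x) \<le> p (r *\<^sub>R x + (r * t) *\<^sub>R y) - (r * t) * p y"
        using q_le r t by simp
      also have "r *\<^sub>R x + (r * t) *\<^sub>R y = r *\<^sub>R (x + t *\<^sub>R y)"
        by (simp add: algebra_simps)
      also have "p \<dots> = r * p (x + t *\<^sub>R y)"
        using sublinear_scale[OF p] r by simp
      finally show "q (r *\<^sub>R x) / r \<le> p (x + t *\<^sub>R y) - t * p y"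
        using r by (simp add: field_simps)
    qed
    with r show "q (r *\<^sub>R x) \<le> r * q x" by (simp add: field_simps)
  qed
  moreover have "q x \<le> p x" and "q x \<le> p (x + y) - p y" for x
    using q_le[of 0 x] q_le[of 1 x] by auto
  ultimately show ?thesis using that by blast
qed

text \<open>Two members, q used at x and r at y, can both be replaced by the smaller one, whence
  subadditivity. The common bound p keeps the infimum finite, as
  \<open>- p (- x) \<le> q x\<close>.\<close>

lemma sublinear_INF_chain:
  assumes ne: "C \<noteq> {}" and sub: "\<And>q. q \<in> C \<Longrightarrow> sublinear q"
    and le: "\<And>q x. q \<in> C \<Longrightarrow> q x \<le> p x"
    and chain: "\<And>q r. q \<in> C \<Longrightarrow> r \<in> C \<Longrightarrow> q \<le> r \<or> r \<le> q"
  shows "sublinear (\<lambda>x. INF q\<in>C. q x)" and "\<And>q x. q \<in> C \<Longrightarrow> (INF q\<in>C. q x) \<le> q x"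
proof -
  have "- p (- x) \<le> q x" if "q \<in> C" for q x
    using sublinear_minus[OF sub[OF that], of x] le[OF that, of "- x"] by simp
  then show lower: "(INF q\<in>C. q x) \<le> q x" if "q \<in> C" for q x
    using that by (intro cINF_lower bdd_belowI2) auto
  have greatest: "b \<le> (INF q\<in>C. q x)" if "\<And>q. q \<in> C \<Longrightarrow> b \<le> q x" for b x
    using that ne by (intro cINF_greatest) auto
  show "sublinear (\<lambda>x. INF q\<in>C. q x)"
  proof (rule sublinearI)
    fix x y
    have *: "(INF q\<in>C. q (x + y)) \<le> q x + r y" if qr: "q \<in> C" "r \<in> C" for q r
    proof -
      obtain h where h: "h \<in> C" "h \<le> q" "h \<le> r"
        using chain[OF qr] qr by blast
      have "(INF q\<in>C. q (x + y)) \<le> h x + h y"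
        using lower[OF h(1)] sublinear_add[OF sub[OF h(1)]] by (rule order_trans)
      with h show ?thesis by (smt (verit) le_funD)
    qed
    have "(INF q\<in>C. q (x + y)) - q x \<le> (INF q\<in>C. q y)" if "q \<in> C" for q
      by (rule greatest) (use * that in fastforce)
    then have "(INF q\<in>C. q (x + y)) - (INF q\<in>C. q y) \<le> (INF q\<in>C. q x)"
      by (intro greatest) fastforce
    then show "(INF q\<in>C. q (x + y)) \<le> (INF q\<in>C. q x) + (INF q\<in>C. q y)" by simp
  next
    fix t :: real and x assume t: "0 < t"
    have "(INF q\<in>C. q (t *\<^sub>R x)) / t \<le> (INF q\<in>C. q x)"
    proof (rule greatest)
      fix q assume "q \<in> C"
      then show "(INF q\<in>C. q (t *\<^sub>R x)) / t \<le> q x"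
        using lower[of q "t *\<^sub>R x"] sublinear_scale_le[OF sub t, of q x] t by (simp add: field_simps)
    qed
    with t show "(INF q\<in>C. q (t *\<^sub>R x)) \<le> t * (INF q\<in>C. q x)" by (simp add: field_simps)
  qed
qed

text \<open>A minimal sublinear function is linear, since it coincides with its tilts.\<close>

lemma linear_below_sublinear:
  assumes p: "sublinear p"
  obtains f where "linear f" "\<And>x. f x \<le> p x"
proof -
  define A where "A = {q. sublinear q \<and> q \<le> p}"
  have "\<exists>m\<in>A. \<forall>a\<in>A. a \<le> m \<longrightarrow> a = m"
  proof (rule predicate_Zorn)
    \<comment> \<open>The order is reversed, so that Zorn's lemma yields a pointwise minimal
      element.\<close>
    show "partial_order_on A (relation_of (\<lambda>x y. y \<le> x) A)"
      by (rule partial_order_on_relation_ofI) auto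
  next
    fix C assume C: "C \<in> Chains (relation_of (\<lambda>x y. y \<le> x) A)"
    then have CA: "C \<subseteq> A" and chain: "\<And>q r. q \<in> C \<Longrightarrow> r \<in> C \<Longrightarrow> q \<le> r \<or> r \<le> q"
      by (auto simp: Chains_def relation_of_def)
    show "\<exists>u\<in>A. \<forall>a\<in>C. u \<le> a"
    proof (cases "C = {}")
      case True
      with p show ?thesis by (auto simp: A_def)
    next
      case False
      define u where "u = (\<lambda>x. INF q\<in>C. q x)"
      have "sublinear u" and le: "\<And>q x. q \<in> C \<Longrightarrow> u x \<le> q x"
        unfolding u_def
        using CA chain False
        by (intro sublinear_INF_chain[where p = p]; auto simp: A_def le_fun_def)+
      moreover have "u \<le> p"
      proof -
        obtain q where "q \<in> C" using False by blast
        with CA le[of q] show ?thesis unfolding A_def le_fun_def by (blast intro: order_trans)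
      qed
      ultimately show ?thesis by (auto simp: A_def le_fun_def intro!: bexI[of _ u])
    qed
  qed
  then obtain f where f: "sublinear f" "f \<le> p" and min: "\<And>q. sublinear q \<Longrightarrow> q \<le> f \<Longrightarrow> q = f"
    by (auto simp: A_def dest: order_trans)
  have add: "f (x + y) = f x + f y" for x y
  proof -
    obtain q where q: "sublinear q" "\<And>x. q x \<le> f x" "\<And>x. q x \<le> f (x + y) - f y"
      using sublinear_tilt[OF f(1)] by metis
    have "q = f" using q by (intro min) (auto simp: le_fun_def)
    with q(3)[of x] sublinear_add[OF f(1), of x y] show ?thesis by simp
  qed
  have minus: "f (- x) = - f x" for x
    using add[of x "- x"] sublinear_zero[OF f(1)] by simp
  have "f (r *\<^sub>R x) = r * f x" for r x
  proof (cases "0 \<le> r")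
    case True
    then show ?thesis by (rule sublinear_scale[OF f(1)])
  next
    case False
    then show ?thesis using sublinear_scale[OF f(1), of "- r" x] minus[of "r *\<^sub>R x"] by simp
  qed
  with add have "linear f" by (intro linearI) auto
  with f(2) show ?thesis using that by (auto simp: le_fun_def)
qed

text \<open>Tilting at z first forces the value at - z down to - p z, so linearity pushes the value
  at z up to p z.\<close>

lemma hahn_banach_sublinear:
  assumes p: "sublinear p"
  obtains f where "linear f" "\<And>x. f x \<le> p x" "f z = p z"
proof -
  obtain q where q: "sublinear q" "\<And>x. q x \<le> p x" "\<And>x. q x \<le> p (x + z) - p z"
    using sublinear_tilt[OF p] by metis
  obtain f where f: "linear f" "\<And>x. f x \<le> q x"
    using linear_below_sublinear[OF q(1)] by blast
  have "f (- z) \<le> - p z"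
    using f(2)[of "- z"] q(3)[of "- z"] sublinear_zero[OF p] by simp
  then have "p z \<le> f z" using linear_neg[OF f(1), of z] by simp
  moreover have "f x \<le> p x" for x using f(2) q(2) order_trans by blast
  ultimately show ?thesis using that[of f] f(1) by (auto intro: antisym)
qed

section \<open>Slopes in the directions of a Lipschitz function\<close>

text \<open>The step from w to w + t (x + y) can be made through w + t x, which makes the supremum
  subadditive; rescaling t gives homogeneity, and the Lipschitz bound gives finiteness.\<close>

lemma sublinear_directional_slopes:
  fixes g :: "'a::real_normed_vector \<Rightarrow> real"
  assumes g: "K-lipschitz_on UNIV g"
  defines "p \<equiv> \<lambda>x. SUP (w, t)\<in>UNIV \<times> {0<..}. (g (w + t *\<^sub>R x) - g w) / t"
  shows "sublinear p" and "p x \<le> K * norm x"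
    and "0 < t \<Longrightarrow> (g (w + t *\<^sub>R x) - g w) / t \<le> p x"
    and "a < p x \<Longrightarrow> \<exists>w t. 0 < t \<and> a < (g (w + t *\<^sub>R x) - g w) / t"
proof -
  have bound: "(g (w + t *\<^sub>R x) - g w) / t \<le> K * norm x" if "0 < t" for w t x
    using lipschitz_onD[OF g, of "w + t *\<^sub>R x" w] that
    by (simp add: dist_norm field_simps abs_le_iff)
  have bdd: "bdd_above ((\<lambda>(w, t). (g (w + t *\<^sub>R x) - g w) / t) ` (UNIV \<times> {0<..}))" for x
    using bound by (intro bdd_aboveI2[where M = "K * norm x"]) auto
  show upper: "(g (w + t *\<^sub>R x) - g w) / t \<le> p x" if "0 < t" for w t x
    unfolding p_def using that by (intro cSUP_upper2[OF bdd, of "(w, t)"]) auto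
  have least: "p x \<le> b" if "\<And>w t. 0 < t \<Longrightarrow> (g (w + t *\<^sub>R x) - g w) / t \<le> b" for x b
    unfolding p_def using that by (intro cSUP_least) (auto intro: exI[of _ 1])
  show "p x \<le> K * norm x" using bound by (rule least)
  show "\<exists>w t. 0 < t \<and> a < (g (w + t *\<^sub>R x) - g w) / t" if "a < p x"
    using that least[of x a] by (meson not_le)
  show "sublinear p"
  proof (rule sublinearI)
    fix x y
    show "p (x + y) \<le> p x + p y"
    proof (rule least)
      fix w and t :: real assume t: "0 < t"
      have "(g (w + t *\<^sub>R (x + y)) - g w) / t
          = (g ((w + t *\<^sub>R x) + t *\<^sub>R y) - g (w + t *\<^sub>R x)) / t + (g (w + t *\<^sub>R x) - g w) / t"
        using t by (simp add: field_simps scaleR_add_right add.assoc)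
      also have "\<dots> \<le> p y + p x" using upper t by (intro add_mono) auto
      finally show "(g (w + t *\<^sub>R (x + y)) - g w) / t \<le> p x + p y" by simp
    qed
  next
    fix r :: real and x assume r: "0 < r"
    show "p (r *\<^sub>R x) \<le> r * p x"
    proof (rule least)
      fix w and t :: real assume t: "0 < t"
      then show "(g (w + t *\<^sub>R r *\<^sub>R x) - g w) / t \<le> r * p x"
        using upper[of "t * r" w x] r by (simp add: field_simps)
    qed
  qed
qed

section \<open>Directions almost aligned with a given vector\<close>

text \<open>
  The added axiom holds over both scalar fields: over \<open>\<complex>\<close> it is
  \<open>F x = f x - \<i> f (\<i> x)\<close>.
\<close>

locale normed_space_real_parts = normed_space_over smul
  for smul :: "'k::{real_normed_field,euclidean_space} \<Rightarrow> 'a::real_normed_vector \<Rightarrow> 'a" +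
  assumes ex_dual_real_part:
    "bounded_linear f \<Longrightarrow> \<exists>F\<in>dual_space smul. \<forall>x. F x \<bullet> 1 = f x"

lemma normed_space_real_parts_scaleR:
  "normed_space_real_parts (scaleR :: real \<Rightarrow> 'a::real_normed_vector \<Rightarrow> 'a)"
proof -
  interpret normed_space_over "scaleR :: real \<Rightarrow> 'a \<Rightarrow> 'a"
    by (rule normed_space_over_scaleR)
  show ?thesis
    by unfold_locales (auto simp: dual_space_def linear_simps intro!: bexI)
qed

lemma normed_space_real_parts_complex:
  fixes scaleC :: "complex \<Rightarrow> 'a::real_normed_vector \<Rightarrow> 'a"
  assumes "normed_space_over scaleC"
  shows "normed_space_real_parts scaleC"
proof -
  interpret normed_space_over scaleC by fact
  show ?thesis
  proof
    fix f :: "'a \<Rightarrow> real" assume f: "bounded_linear f"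
    interpret f: bounded_linear f by fact
    have i_scaleR: "scaleC \<i> (r *\<^sub>R x) = r *\<^sub>R scaleC \<i> x" for r x
      by (simp flip: smul_of_real add: mult.commute)
    have "bounded_linear (scaleC \<i>)"
      by (rule bounded_linear_intro[where K = 1])
         (auto simp: scale_right_distrib i_scaleR norm_smul)
    then have fi: "bounded_linear (\<lambda>x. f (scaleC \<i> x))"
      by (rule bounded_linear_compose[OF f])
    define F where "F x = Complex (f x) (- f (scaleC \<i> x))" for x
    have F_eq: "F = (\<lambda>x. complex_of_real (f x) - \<i> * complex_of_real (f (scaleC \<i> x)))"
      by (auto simp: F_def complex_eq_iff)
    have "bounded_linear F"
      unfolding F_eq using f fi
      by (intro bounded_linear_sub bounded_linear_const_mult bounded_linear_compose[OF bounded_linear_of_real])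
    moreover have "F (scaleC c x) = c * F x" for c x
    proof -
      \<comment> \<open>As f is only real-linear, c x and i c x are expanded into real multiples of
        x and i x before f is applied.\<close>
      have c: "scaleC c x = Re c *\<^sub>R x + Im c *\<^sub>R scaleC \<i> x"
      proof -
        have "c = of_real (Re c) + of_real (Im c) * \<i>" by (simp add: complex_eq_iff)
        then have "scaleC c x = scaleC (of_real (Re c) + of_real (Im c) * \<i>) x" by simp
        then show ?thesis
          by (simp only: scale_left_distrib smul_of_real scale_scale[symmetric])
      qed
      have ic: "scaleC \<i> (scaleC c x) = Re c *\<^sub>R scaleC \<i> x - Im c *\<^sub>R x"
      proof -
        have "scaleC \<i> (scaleC \<i> x) = - x" by (simp add: scale_minus_left)
        then show ?thesis by (simp add: c scale_right_distrib i_scaleR)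
      qed
      show ?thesis
        unfolding F_def ic unfolding c by (simp add: complex_eq_iff f.add f.diff f.scaleR)
    qed
    ultimately show "\<exists>F\<in>dual_space scaleC. \<forall>x. F x \<bullet> 1 = f x"
      by (intro bexI[of _ F]) (auto simp: dual_space_def F_def inner_one_complex)
  qed
qed

context normed_space_real_parts
begin

lemma smul_scaleR: "smul c (r *\<^sub>R x) = r *\<^sub>R smul c x"
  by (simp flip: smul_of_real add: mult.commute)

lemma bounded_linear_smul: "bounded_linear (smul c)"
  by (rule bounded_linear_intro[where K = "norm c"])
     (auto simp: scale_right_distrib smul_scaleR norm_smul mult.commute)

lemma bounded_linear_smul_left: "bounded_linear (\<lambda>c. smul c x)"
proof (rule bounded_linear_intro[where K = "norm x"])
  show "smul (r *\<^sub>R c) x = r *\<^sub>R smul c x" for r c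
    by (simp add: scaleR_conv_of_real smul_of_real flip: scale_scale)
qed (auto simp: scale_left_distrib norm_smul)

text \<open>Product and inner product of the scalars are linked through the norm: 1 has norm 1,
  hence inner square 1.\<close>

lemma of_real_inner_one: "(of_real r :: 'k) \<bullet> 1 = r"
proof -
  have "(1::'k) \<bullet> 1 = 1" by (simp flip: power2_norm_eq_inner)
  then show ?thesis by (simp add: of_real_def)
qed

lemma inner_one_le_norm: "(c :: 'k) \<bullet> 1 \<le> norm c"
  using norm_cauchy_schwarz[of c 1] by simp

text \<open>The rank-one operator built from F / \<open>onorm F\<close> and y has norm 1, so the
  property yields a rotation with norm exactly 2, which some unit vector almost attains.\<close>

lemma onorm_id_plus_rank_one_approx:
  assumes aDP: "alternative_Daugavet_property smul"
    and F: "F \<in> dual_space smul" "onorm F > 0" and y: "norm y = 1"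
    and \<delta>: "0 < \<delta>" "\<delta> \<le> 1"
  obtains x \<theta> where "norm x = 1" "norm \<theta> = 1"
    "2 - \<delta> < norm (x + smul (\<theta> * (F x / of_real (onorm F))) y)"
proof -
  define N where "N = onorm F"
  have N: "0 < N" using F(2) by (simp add: N_def)
  have F_lin: "bounded_linear F" and F_smul: "\<And>c x. F (smul c x) = c * F x"
    using F(1) by (auto simp: dual_space_def)
  define R where "R x = smul (F x / of_real N) y" for x
  have norm_R: "norm (R x) = norm (F x) / N" for x
    using N y by (simp add: R_def norm_smul norm_divide)
  have R_lin: "bounded_linear R"
    unfolding R_def
    by (intro bounded_linear_compose[OF bounded_linear_smul_left]
        bounded_linear_compose[OF bounded_linear_divide] F_lin)
  then have "R \<in> bounded_operators smul"
    by (auto simp: bounded_operators_def R_def F_smul)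
  moreover have "rank_one smul R"
    unfolding rank_one_def
  proof (intro exI conjI)
    show "y \<noteq> 0" using y by auto
    obtain x where x: "F x \<noteq> 0"
      using F(2) onorm_eq_0[OF F_lin] by auto
    have *: "smul c y = R (smul (c * of_real N / F x) x)" for c
      using x N by (simp add: R_def F_smul)
    have "smul c y \<in> range R" for c
      unfolding * by blast
    moreover have "R z \<in> range (\<lambda>c. smul c y)" for z
      unfolding R_def by blast
    ultimately show "range R = range (\<lambda>c. smul c y)"
      by blast
  qed
  moreover have "onorm R = 1"
  proof (rule antisym)
    show "onorm R \<le> 1"
      using onorm[OF F_lin] N by (intro onorm_bound) (auto simp: norm_R field_simps N_def)
    have "norm (F x) \<le> onorm R * N * norm x" for x
      using onorm[OF R_lin, of x] N by (simp add: norm_R field_simps)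
    then have "N \<le> onorm R * N"
      using N onorm_pos_le[OF R_lin] unfolding N_def by (intro onorm_bound) auto
    with N show "1 \<le> onorm R" by simp
  qed
  ultimately obtain \<theta> where \<theta>: "norm \<theta> = 1" "onorm (\<lambda>x. x + smul \<theta> (R x)) = 2"
    using aDP by (fastforce simp: alternative_Daugavet_property_def is_max_def)
  \<comment> \<open>\<open>\<delta> \<le> 1\<close> keeps 2 - \<delta> nonnegative, as a bound on an
    operator norm must be. The vector found is normalised afterwards.\<close>
  have "\<exists>x. (2 - \<delta>) * norm x < norm (x + smul \<theta> (R x))"
  proof (rule ccontr)
    assume "\<not> ?thesis"
    then have "onorm (\<lambda>x. x + smul \<theta> (R x)) \<le> 2 - \<delta>"
      using \<delta> by (intro onorm_bound) (auto simp: not_less)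
    with \<theta> \<delta> show False by simp
  qed
  then obtain z where z: "(2 - \<delta>) * norm z < norm (z + smul \<theta> (R z))" by blast
  then have "z \<noteq> 0" by (auto simp: linear_simps R_lin)
  define x where "x = z /\<^sub>R norm z"
  have "norm x = 1" using \<open>z \<noteq> 0\<close> by (simp add: x_def)
  moreover have "x + smul \<theta> (R x) = (z + smul \<theta> (R z)) /\<^sub>R norm z"
    by (simp add: x_def linear_simps R_lin smul_scaleR algebra_simps)
  then have "norm (x + smul \<theta> (R x)) = norm (z + smul \<theta> (R z)) / norm z"
    by (simp add: divide_inverse mult.commute)
  with z \<open>z \<noteq> 0\<close> have "2 - \<delta> < norm (x + smul \<theta> (R x))"
    by (simp add: pos_less_divide_eq)
  ultimately show ?thesis using that[of x \<theta>] \<theta> by (simp add: R_def N_def)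
qed

text \<open>If x + \<theta> c y with c = F x / N has norm almost 2, then c has modulus almost 1.
  Rotating x by the phase of c makes F x real and almost N, and replacing c by its phase changes the
  norm only a little.\<close>

lemma aligned_in_linear_slice:
  assumes aDP: "alternative_Daugavet_property smul"
    and F: "F \<in> dual_space smul" "a < onorm F" and y: "norm y = 1" and e: "0 < e"
  obtains x \<theta> where "norm x = 1" "norm \<theta> = 1" "2 - e < norm (y + smul \<theta> x)" "a < F x \<bullet> 1"
proof (cases "onorm F = 0")
  case True
  \<comment> \<open>Here F = 0 and a < 0: the slice is the whole sphere, and y is aligned with
    itself.\<close>
  have "F y = 0"
    using True F onorm_eq_0 by (auto simp: dual_space_def)
  moreover have "norm (y + smul 1 y) = 2"
    using y by (simp flip: scaleR_2)
  ultimately show ?thesis using that[of y 1] True F(2) y e by simp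
next
  case False
  define N where "N = onorm F"
  have F_lin: "bounded_linear F" and F_smul: "\<And>c x. F (smul c x) = c * F x"
    using F(1) by (auto simp: dual_space_def)
  have N: "0 < N" using False onorm_pos_le[OF F_lin] by (simp add: N_def)
  \<comment> \<open>The alignment loses \<delta> twice, hence e / 2; the last entry ensures a \<le>
    N (1 - \<delta>), and the entry 1 makes c nonzero.\<close>
  define \<delta> where "\<delta> = min 1 (min (e / 2) ((N - a) / N))"
  have \<delta>: "0 < \<delta>" "\<delta> \<le> 1" "\<delta> \<le> e / 2" "\<delta> \<le> (N - a) / N"
    using e N F(2) unfolding \<delta>_def N_def[symmetric] by (simp_all add: min.coboundedI2 min.coboundedI1 del: min_le_iff_disj le_divide_eq_numeral1)
  obtain x \<theta> where x: "norm x = 1" "norm \<theta> = 1"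
    and big: "2 - \<delta> < norm (x + smul (\<theta> * (F x / of_real N)) y)"
    using onorm_id_plus_rank_one_approx[OF aDP F(1) _ y \<delta>(1,2)] N unfolding N_def by metis
  define c where "c = F x / of_real N"
  define k where "k = norm c"
  have "norm (F x) \<le> N" using onorm[OF F_lin, of x] x by (simp add: N_def)
  then have k_le: "k \<le> 1" using N by (simp add: k_def c_def norm_divide)
  have "norm (x + smul (\<theta> * c) y) \<le> 1 + k"
    using norm_triangle_ineq[of x "smul (\<theta> * c) y"] x y by (simp add: norm_smul norm_mult k_def)
  with big have k_gt: "1 - \<delta> < k" by (simp add: c_def)
  with \<delta> have k0: "0 < k" by simp
  then have c0: "c \<noteq> 0" by (auto simp: k_def)
  define \<omega> where "\<omega> = c / of_real k"
  have \<omega>: "norm \<omega> = 1" "c = of_real k * \<omega>" and \<omega>0: "\<omega> \<noteq> 0"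
    using k0 c0 by (auto simp: \<omega>_def norm_divide k_def)
  define x' where "x' = smul (1 / \<omega>) x"
  have \<theta>0: "\<theta> \<noteq> 0" using x by auto
  have "norm (smul (\<theta> * c) y - smul (\<theta> * \<omega>) y) = 1 - k"
  proof -
    have "\<theta> * c - \<theta> * \<omega> = of_real (k - 1) * (\<theta> * \<omega>)"
      by (simp add: \<omega>(2) algebra_simps)
    then have "smul (\<theta> * c) y - smul (\<theta> * \<omega>) y = smul (of_real (k - 1) * (\<theta> * \<omega>)) y"
      by (metis scale_left_diff_distrib)
    then show ?thesis
      using x y \<omega> k_le by (simp add: norm_smul norm_mult del: of_real_diff)
  qed
  moreover have "norm (x + smul (\<theta> * c) y)
      \<le> norm (x + smul (\<theta> * \<omega>) y) + norm (smul (\<theta> * c) y - smul (\<theta> * \<omega>) y)"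
    using norm_triangle_sub[of "x + smul (\<theta> * c) y" "x + smul (\<theta> * \<omega>) y"] by simp
  ultimately have "2 - 2 * \<delta> < norm (x + smul (\<theta> * \<omega>) y)"
    using big k_gt by (simp add: c_def)
  also have "x + smul (\<theta> * \<omega>) y = smul (\<theta> * \<omega>) (y + smul (1 / \<theta>) x')"
    using \<theta>0 \<omega>0 by (simp add: x'_def scale_right_distrib add.commute)
  also have "norm \<dots> = norm (y + smul (1 / \<theta>) x')"
    using x \<omega> by (simp add: norm_smul norm_mult)
  finally have "2 - e < norm (y + smul (1 / \<theta>) x')" using \<delta> by simp
  moreover have "F x' = of_real (N * k)"
    using N \<omega>0 \<omega>(2) by (simp add: x'_def F_smul c_def field_simps)
  then have "F x' \<bullet> 1 = N * k" by (simp only: of_real_inner_one)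
  moreover have "a < N * k"
  proof -
    have "a \<le> N * (1 - \<delta>)" using \<delta>(4) N by (simp add: field_simps)
    also have "\<dots> < N * k" using k_gt N by simp
    finally show ?thesis .
  qed
  ultimately show ?thesis
    using that[of x' "1 / \<theta>"] x \<omega> by (simp add: x'_def norm_smul norm_divide)
qed

text \<open>A linear f below the directional slopes p of g, touching p at the given direction u, has
  f u > a. So its slice of the sphere is not empty, the linear case applies, and f \<le> p turns the
  direction found there into one with a slope of g above a.\<close>

lemma aligned_in_lipschitz_slice:
  assumes aDP: "alternative_Daugavet_property smul" and T: "L-lipschitz_on UNIV T"
    and F: "F \<in> dual_space smul"
    and x12: "x1 \<noteq> x2" "a < F ((T x1 - T x2) /\<^sub>R norm (x1 - x2)) \<bullet> 1"
    and y: "norm y = 1" and e: "0 < e"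
  obtains z1 z2 \<theta> where "z1 \<noteq> z2" "norm \<theta> = 1"
    "2 - e < norm (y + smul \<theta> ((z1 - z2) /\<^sub>R norm (z1 - z2)))"
    "a < F ((T z1 - T z2) /\<^sub>R norm (z1 - z2)) \<bullet> 1"
proof -
  have F_lin: "bounded_linear F" using F by (simp add: dual_space_def)
  define g where "g x = F (T x) \<bullet> 1" for x
  have g_slope: "F ((T v - T w) /\<^sub>R t) \<bullet> 1 = (g v - g w) / t" for v w t
    by (simp add: g_def linear_simps F_lin inner_diff_left divide_inverse mult.commute)
  have lin: "bounded_linear (\<lambda>x. F x \<bullet> 1)"
    by (rule bounded_linear_compose[OF bounded_linear_inner_left F_lin])
  obtain K where "K-lipschitz_on UNIV (\<lambda>x. F x \<bullet> 1)"
    using bounded_linear.lipschitz_boundE[OF lin] by blast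
  then have "(K * L)-lipschitz_on UNIV g"
    unfolding g_def using lipschitz_on_compose2[OF T] lipschitz_on_subset by blast
  then obtain M where M: "M-lipschitz_on UNIV g" by blast
  define p where "p x = (SUP (w, t)\<in>UNIV \<times> {0<..}. (g (w + t *\<^sub>R x) - g w) / t)" for x
  note p = sublinear_directional_slopes[OF M, folded p_def]
  define u where "u = (x1 - x2) /\<^sub>R norm (x1 - x2)"
  have nu: "norm u = 1" using x12 by (simp add: u_def)
  have "a < (g (x2 + norm (x1 - x2) *\<^sub>R u) - g x2) / norm (x1 - x2)"
    using x12 by (simp add: g_slope u_def)
  also have "\<dots> \<le> p u" using x12 by (intro p(3)) simp
  finally have pu: "a < p u" .
  obtain f where f: "linear f" "\<And>x. f x \<le> p x" "f u = p u"
    using hahn_banach_sublinear[OF p(1)] by metis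
  have "\<bar>f x\<bar> \<le> norm x * M" for x
    using f(2)[of x] f(2)[of "- x"] p(2)[of x] p(2)[of "- x"] linear_neg[OF f(1), of x]
    by (simp add: mult.commute)
  then have "bounded_linear f"
    using f(1) by (intro bounded_linear_intro[where K = M]) (auto simp: linear_add linear_scale)
  then obtain G where G: "G \<in> dual_space smul" "\<And>x. G x \<bullet> 1 = f x"
    using ex_dual_real_part by blast
  have "a < norm (G u)" using pu f(3) G(2)[of u] inner_one_le_norm[of "G u"] by simp
  also have "\<dots> \<le> onorm G" using onorm[of G u] G(1) nu by (simp add: dual_space_def)
  finally obtain x \<theta> where x: "norm x = 1" "norm \<theta> = 1" "2 - e < norm (y + smul \<theta> x)"
    and "a < f x"
    using aligned_in_linear_slice[OF aDP G(1) _ y e] G(2) by metis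
  then have "a < p x" using f(2)[of x] by simp
  then obtain w t where t: "0 < t" "a < (g (w + t *\<^sub>R x) - g w) / t"
    using p(4) by blast
  show ?thesis
  proof (rule that[of "w + t *\<^sub>R x" w \<theta>])
    show "w + t *\<^sub>R x \<noteq> w" using t x by auto
  qed (use t x in \<open>auto simp: g_slope\<close>)
qed

text \<open>With r the norm of y and w the rotated direction, r (y / r + w) is y + w plus (r - 1) w.
  As r \<ge> 1, the extra summand has norm r - 1, and the error e / r for the unit vector becomes
  e.\<close>

lemma aligned_in_lipschitz_slice_scaled:
  assumes aDP: "alternative_Daugavet_property smul" and T: "T \<in> Lip"
    and S: "is_slice smul (slope T) S" and y: "1 \<le> norm y" and e: "0 < e"
  obtains z1 z2 \<theta> where "z1 \<noteq> z2" "norm \<theta> = 1" "(T z1 - T z2) /\<^sub>R norm (z1 - z2) \<in> S"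
    "norm y + 1 - e < norm (y + smul \<theta> ((z1 - z2) /\<^sub>R norm (z1 - z2)))"
proof -
  obtain L where L: "L-lipschitz_on UNIV T" using T by (auto simp: Lip_def)
  obtain F a where F: "F \<in> dual_space smul" and S_eq: "S = {x \<in> slope T. a < F x \<bullet> 1}"
    and "S \<noteq> {}"
    using S by (auto simp: is_slice_def)
  then obtain x1 x2 where x12: "x1 \<noteq> x2" "a < F ((T x1 - T x2) /\<^sub>R norm (x1 - x2)) \<bullet> 1"
    by (auto simp: slope_def)
  define r where "r = norm y"
  have r: "1 \<le> r" using y by (simp add: r_def)
  have "norm (y /\<^sub>R r) = 1" "0 < e / r" using r e by (auto simp: r_def simp flip: norm_le_zero_iff)
  then obtain z1 z2 \<theta> where z: "z1 \<noteq> z2" "norm \<theta> = 1"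
    and big: "2 - e / r < norm (y /\<^sub>R r + smul \<theta> ((z1 - z2) /\<^sub>R norm (z1 - z2)))"
    and slice: "a < F ((T z1 - T z2) /\<^sub>R norm (z1 - z2)) \<bullet> 1"
    using aligned_in_lipschitz_slice[OF aDP L F x12] by metis
  define w where "w = smul \<theta> ((z1 - z2) /\<^sub>R norm (z1 - z2))"
  have nw: "norm w = 1" using z by (simp add: w_def norm_smul)
  have "r * (2 - e / r) < r * norm (y /\<^sub>R r + w)"
    using big r by (simp add: w_def)
  also have "\<dots> = norm (r *\<^sub>R (y /\<^sub>R r + w))" using r by simp
  also have "r *\<^sub>R (y /\<^sub>R r + w) = (y + w) + (r - 1) *\<^sub>R w"
    using r by (simp add: algebra_simps)
  also have "norm \<dots> \<le> norm (y + w) + (r - 1)"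
    using norm_triangle_ineq[of "y + w" "(r - 1) *\<^sub>R w"] r nw by simp
  finally have "r + 1 - e < norm (y + w)" using r by (simp add: right_diff_distrib)
  moreover have "(T z1 - T z2) /\<^sub>R norm (z1 - z2) \<in> S"
    using slice z(1) by (auto simp: S_eq slope_def)
  ultimately show ?thesis using that z by (simp add: r_def w_def)
qed

lemma aligned_sequence:
  assumes aDP: "alternative_Daugavet_property smul" and T: "T \<in> Lip"
    and S: "\<And>n. is_slice smul (slope T) (S n)" and u: "norm u = 1"
    and e: "0 < e" "e \<le> 1"
  obtains x1 x2 :: "nat \<Rightarrow> 'a" and \<theta> :: "nat \<Rightarrow> 'k"
  where "\<And>n. x1 n \<noteq> x2 n" "\<And>n. norm (\<theta> n) = 1"
    "\<And>n. (T (x1 n) - T (x2 n)) /\<^sub>R norm (x1 n - x2 n) \<in> S n"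
    "\<And>n. real n + 1 - e \<le>
       norm (u + (\<Sum>i<n. smul (\<theta> i) ((x1 i - x2 i) /\<^sub>R norm (x1 i - x2 i))))"
proof -
  define dir where "dir z = smul (snd (snd z)) ((fst z - fst (snd z)) /\<^sub>R norm (fst z - fst (snd z)))"
    for z :: "'a \<times> 'a \<times> 'k"
  define ok where "ok n y z \<longleftrightarrow> fst z \<noteq> fst (snd z) \<and> norm (snd (snd z)) = 1
      \<and> (T (fst z) - T (fst (snd z))) /\<^sub>R norm (fst z - fst (snd z)) \<in> S n
      \<and> norm y + 1 - e * (1/2) ^ Suc n < norm (y + dir z)" for n y z
  \<comment> \<open>The tolerance is halved at each step, so all losses add up to at most e.
    Choosing for every y at once lets the recursion below feed in its own partial sums.\<close>
  have "\<exists>z. 1 \<le> norm y \<longrightarrow> ok n y z" for n y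
  proof (cases "1 \<le> norm y")
    case True
    have "0 < e * (1/2) ^ Suc n" using e by simp
    from aligned_in_lipschitz_slice_scaled[OF aDP T S True this]
    obtain z1 z2 \<theta> where "z1 \<noteq> z2" "norm \<theta> = 1" "(T z1 - T z2) /\<^sub>R norm (z1 - z2) \<in> S n"
      "norm y + 1 - e * (1/2) ^ Suc n < norm (y + smul \<theta> ((z1 - z2) /\<^sub>R norm (z1 - z2)))"
      by metis
    then show ?thesis by (intro exI[of _ "(z1, z2, \<theta>)"]) (simp add: ok_def dir_def)
  qed simp
  then have "\<exists>Z. \<forall>n y. 1 \<le> norm y \<longrightarrow> ok n y (Z n y)" by (intro choice allI)
  then obtain Z where Z: "\<And>n y. 1 \<le> norm y \<Longrightarrow> ok n y (Z n y)" by blast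
  define Y where "Y = rec_nat u (\<lambda>n y. y + dir (Z n y))"
  have Y_Suc: "Y (Suc n) = Y n + dir (Z n (Y n))" for n by (simp add: Y_def)
  have Y_sum: "Y n = u + (\<Sum>i<n. dir (Z i (Y i)))" for n
    by (induction n) (simp_all add: Y_Suc, simp add: Y_def)
  \<comment> \<open>With the norm bound that follows, this keeps the partial sums at norm at least
    1, as the next choice requires; here e \<le> 1 enters.\<close>
  have ge: "1 \<le> real n + 1 - e * (1 - (1/2) ^ n)" for n
  proof (cases n)
    case (Suc m)
    have "e * (1 - (1/2) ^ n) \<le> 1 * 1"
      using e by (intro mult_mono) (auto simp: power_le_one)
    with Suc show ?thesis by simp
  qed simp
  have Y_norm: "real n + 1 - e * (1 - (1/2) ^ n) \<le> norm (Y n)" for n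
  proof (induction n)
    case 0
    then show ?case using u by (simp add: Y_def)
  next
    case (Suc n)
    then have "ok n (Y n) (Z n (Y n))" using Z ge[of n] by simp
    with Suc show ?case by (simp add: ok_def Y_Suc algebra_simps)
  qed
  then have okZ: "ok n (Y n) (Z n (Y n))" for n using Z ge[of n] order_trans by blast
  show ?thesis
  proof (rule that[of "\<lambda>n. fst (Z n (Y n))" "\<lambda>n. fst (snd (Z n (Y n)))" "\<lambda>n. snd (snd (Z n (Y n)))"])
    fix n
    have "e * (1 - (1/2) ^ n) \<le> e" using e by (simp add: algebra_simps)
    then show "real n + 1 - e \<le> norm (u + (\<Sum>i<n. smul (snd (snd (Z i (Y i))))
        ((fst (Z i (Y i)) - fst (snd (Z i (Y i)))) /\<^sub>R norm (fst (Z i (Y i)) - fst (snd (Z i (Y i)))))))"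
      using Y_norm[of n] Y_sum[of n] by (simp add: dir_def)
  qed (use okZ in \<open>auto simp: ok_def\<close>)
qed

end

section \<open>Lipschitz norms\<close>

lemma bdd_above_lip_quotients:
  "L-lipschitz_on UNIV T \<Longrightarrow> bdd_above {norm (T x1 - T x2) / norm (x1 - x2) |x1 x2. x1 \<noteq> x2}"
  using lipschitz_onD[of L UNIV T]
  by (intro bdd_aboveI[where M = L]) (auto simp: divide_le_eq dist_norm)

lemma lip_norm_ge:
  assumes "T \<in> Lip" "x1 \<noteq> x2"
  shows "norm ((T x1 - T x2) /\<^sub>R norm (x1 - x2)) \<le> lip_norm T"
proof -
  have "norm (T x1 - T x2) / norm (x1 - x2) \<le> lip_norm T"
    unfolding lip_norm_def
  proof (rule cSup_upper)
    show "bdd_above {norm (T x1 - T x2) / norm (x1 - x2) |x1 x2. x1 \<noteq> x2}"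
      using assms(1) bdd_above_lip_quotients by (auto simp: Lip_def)
  qed (use assms(2) in blast)
  then show ?thesis by (simp add: divide_inverse mult.commute)
qed

lemma lip_norm_bound:
  assumes "T \<in> Lip"
  shows "norm (T x1 - T x2) \<le> lip_norm T * norm (x1 - x2)"
  using lip_norm_ge[OF assms, of x1 x2]
  by (cases "x1 = x2") (simp_all add: divide_le_eq flip: divide_inverse_commute)

text \<open>Two distinct points make the set of quotients nonempty, so that its supremum is
  meaningful.\<close>

lemma lip_norm_least:
  fixes T :: "'a::real_normed_vector \<Rightarrow> 'a"
  assumes "(a::'a) \<noteq> b" "\<And>x1 x2. norm (T x1 - T x2) \<le> K * norm (x1 - x2)"
  shows "lip_norm T \<le> K"
  unfolding lip_norm_def using assms by (intro cSup_least) (auto simp: divide_le_eq)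

lemma ex_slope_norm_gt:
  assumes "(a::'a::real_normed_vector) \<noteq> b" "r < lip_norm T"
  shows "\<exists>s\<in>slope (T :: 'a \<Rightarrow> 'a). r < norm s"
proof -
  have "{norm (T x1 - T x2) / norm (x1 - x2) |x1 x2. x1 \<noteq> x2} \<noteq> {}"
    using assms(1) by blast
  then obtain x1 x2 where x: "x1 \<noteq> x2" "r < norm (T x1 - T x2) / norm (x1 - x2)"
    using less_cSupE[OF assms(2)[unfolded lip_norm_def]] by blast
  have "(T x1 - T x2) /\<^sub>R norm (x1 - x2) \<in> slope T"
    using x(1) unfolding slope_def by blast
  moreover have "r < norm ((T x1 - T x2) /\<^sub>R norm (x1 - x2))"
    using x(2) by (simp add: divide_inverse mult.commute)
  ultimately show ?thesis by blast
qed

context normed_space_real_parts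
begin

lemma id_plus_smul_Lip:
  assumes "T \<in> Lip"
  shows "(\<lambda>x. x + smul \<theta> (T x)) \<in> Lip"
proof -
  obtain L where "L-lipschitz_on UNIV T" using assms by (auto simp: Lip_def)
  moreover obtain M where "M-lipschitz_on UNIV (smul \<theta>)"
    using bounded_linear.lipschitz_boundE[OF bounded_linear_smul] by blast
  ultimately have "(M * L)-lipschitz_on UNIV (\<lambda>x. smul \<theta> (T x))"
    using lipschitz_on_compose2 lipschitz_on_subset by blast
  then have "(1 + M * L)-lipschitz_on UNIV (\<lambda>x. x + smul \<theta> (T x))"
    by (intro lipschitz_on_add lipschitz_on_id)
  then show ?thesis unfolding Lip_def by blast
qed

text \<open>Used twice: \<phi> = 0 leads to the upper bound 1 + \<open>lip_norm T\<close>, and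
  exchanging \<theta> and \<phi> gives continuity in the rotation.\<close>

lemma lip_norm_id_plus_diff_le:
  assumes T: "T \<in> Lip" and ab: "(a::'a) \<noteq> b"
  shows "lip_norm (\<lambda>x. x + smul \<theta> (T x))
    \<le> lip_norm (\<lambda>x. x + smul \<phi> (T x)) + norm (\<theta> - \<phi>) * lip_norm T"
proof (rule lip_norm_least[OF ab])
  fix x1 x2
  have "x1 + smul \<theta> (T x1) - (x2 + smul \<theta> (T x2))
      = (x1 + smul \<phi> (T x1) - (x2 + smul \<phi> (T x2))) + smul (\<theta> - \<phi>) (T x1 - T x2)"
    by (simp add: scale_left_diff_distrib scale_right_diff_distrib)
  also have "norm \<dots> \<le> lip_norm (\<lambda>x. x + smul \<phi> (T x)) * norm (x1 - x2)
      + norm (\<theta> - \<phi>) * (lip_norm T * norm (x1 - x2))"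
    using lip_norm_bound[OF id_plus_smul_Lip[OF T]] lip_norm_bound[OF T]
    by (intro norm_triangle_mono) (auto simp: norm_smul intro: mult_left_mono)
  finally show "norm (x1 + smul \<theta> (T x1) - (x2 + smul \<theta> (T x2)))
      \<le> (lip_norm (\<lambda>x. x + smul \<phi> (T x)) + norm (\<theta> - \<phi>) * lip_norm T) * norm (x1 - x2)"
    by (simp add: algebra_simps)
qed

lemma lip_norm_id_plus_le:
  assumes T: "T \<in> Lip" and ab: "(a::'a) \<noteq> b" and \<theta>: "norm \<theta> = 1"
  shows "lip_norm (\<lambda>x. x + smul \<theta> (T x)) \<le> 1 + lip_norm T"
proof -
  have "lip_norm (\<lambda>x. x + smul 0 (T x)) \<le> 1"
    by (rule lip_norm_least[OF ab]) simp
  then show ?thesis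
    using lip_norm_id_plus_diff_le[OF T ab, of \<theta> 0] \<theta> by simp
qed

text \<open>The unit sphere of the scalars is compact and the norm depends continuously on the
  rotation, so approximate rotations yield an exact maximiser.\<close>

lemma alternative_Daugavet_equationI:
  assumes T: "T \<in> Lip" and ab: "(a::'a) \<noteq> b"
    and approx: "\<And>e. 0 < e \<Longrightarrow>
      \<exists>\<theta>. norm \<theta> = 1 \<and> 1 + lip_norm T - e \<le> lip_norm (\<lambda>x. x + smul \<theta> (T x))"
  shows "alternative_Daugavet_equation smul T"
proof -
  define h where "h \<theta> = lip_norm (\<lambda>x. x + smul \<theta> (T x))" for \<theta>
  have "0 \<le> lip_norm T"
    using lip_norm_ge[OF T ab] norm_ge_zero order_trans by blast
  then have "(lip_norm T)-lipschitz_on UNIV h"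
  proof (intro lipschitz_onI)
    fix \<theta> \<phi>
    have "h \<theta> \<le> h \<phi> + dist \<theta> \<phi> * lip_norm T" "h \<phi> \<le> h \<theta> + dist \<theta> \<phi> * lip_norm T"
      using lip_norm_id_plus_diff_le[OF T ab, of \<theta> \<phi>] lip_norm_id_plus_diff_le[OF T ab, of \<phi> \<theta>]
      by (simp_all add: h_def dist_norm norm_minus_commute[of \<phi> \<theta>])
    then show "dist (h \<theta>) (h \<phi>) \<le> lip_norm T * dist \<theta> \<phi>"
      by (simp add: dist_real_def abs_le_iff mult.commute)
  qed
  then have "continuous_on (sphere 0 1) h"
    using lipschitz_on_continuous_on continuous_on_subset by blast
  moreover have "(1::'k) \<in> sphere 0 1" by simp
  then have "sphere (0::'k) 1 \<noteq> {}" by blast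
  ultimately obtain \<theta> where \<theta>: "norm \<theta> = 1" and max: "\<And>\<phi>. norm \<phi> = 1 \<Longrightarrow> h \<phi> \<le> h \<theta>"
    using continuous_attains_sup[of "sphere 0 1" h] by auto
  have "1 + lip_norm T \<le> h \<theta> + e" if "0 < e" for e
    using approx[OF that] max unfolding h_def by fastforce
  then have "1 + lip_norm T \<le> h \<theta>" by (rule field_le_epsilon)
  moreover have "h \<phi> \<le> 1 + lip_norm T" if "norm \<phi> = 1" for \<phi>
    using lip_norm_id_plus_le[OF T ab that] by (simp add: h_def)
  ultimately show ?thesis
    using \<theta> unfolding alternative_Daugavet_equation_def is_max_def h_def[symmetric]
    by (auto intro: order_antisym)
qed

end

section \<open>The alternative Daugavet equation\<close>

lemma convex_hull_range_coeffs:
  fixes v :: "nat \<Rightarrow> 'a::real_vector"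
  assumes "s \<in> convex hull (range v)"
  obtains n c where "\<And>i. 0 \<le> c i" "\<And>i. c i \<le> 1" "sum c {..<n} = 1" "s = (\<Sum>i<n. c i *\<^sub>R v i)"
proof -
  obtain F u where F: "finite F" "F \<subseteq> range v" and u: "\<And>x. x \<in> F \<Longrightarrow> 0 \<le> u x"
    "sum u F = 1" "(\<Sum>x\<in>F. u x *\<^sub>R x) = s"
    using assms unfolding convex_hull_explicit by blast
  \<comment> \<open>The sequence v may repeat values, so one index is chosen for each point of F;
    the coefficients vanish at all other indices.\<close>
  obtain J where J: "inj_on v J" "F = v ` J"
    using F(2) by (metis subset_image_inj)
  have finJ: "finite J" using F(1) J by (simp add: finite_image_iff)
  then obtain n where n: "J \<subseteq> {..<n}" using finite_nat_iff_bounded by blast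
  define c where "c i = (if i \<in> J then u (v i) else 0)" for i
  have restrict: "(\<Sum>i<n. c i *\<^sub>R v i) = (\<Sum>i\<in>J. c i *\<^sub>R v i)" "sum c {..<n} = sum c J"
    using n by (intro sum.mono_neutral_right; simp add: c_def)+
  show ?thesis
  proof (rule that[of c n])
    show c_ge: "0 \<le> c i" for i using u(1) J by (simp add: c_def)
    show sum: "sum c {..<n} = 1"
      using u(2) J unfolding restrict by (simp add: sum.reindex c_def)
    show "c i \<le> 1" for i
    proof (cases "i \<in> J")
      case True
      then show ?thesis
        using member_le_sum[of i J c] c_ge finJ sum restrict by simp
    qed (simp add: c_def)
    show "s = (\<Sum>i<n. c i *\<^sub>R v i)"
      using u(3) J unfolding restrict by (simp add: sum.reindex c_def)
  qed
qed

text \<open>Raising every weight to M adds vectors of total length at most the sum of the M -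
  \<open>c i\<close>. So the weighted sum falls short by no more than M times the defect of the
  plain sum.\<close>

lemma norm_aligned_combination:
  fixes w :: "'i \<Rightarrow> 'a::real_normed_vector"
  assumes w: "\<And>i. i \<in> I \<Longrightarrow> norm (w i) = 1" and c: "\<And>i. i \<in> I \<Longrightarrow> c i \<le> M"
    and M: "0 \<le> M" and sum: "real (card I) - e \<le> norm (\<Sum>i\<in>I. w i)"
  shows "(\<Sum>i\<in>I. c i) - M * e \<le> norm (\<Sum>i\<in>I. c i *\<^sub>R w i)"
proof -
  have "M *\<^sub>R (\<Sum>i\<in>I. w i) = (\<Sum>i\<in>I. c i *\<^sub>R w i) + (\<Sum>i\<in>I. (M - c i) *\<^sub>R w i)"
    by (simp add: scaleR_sum_right algebra_simps flip: sum.distrib)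
  then have "M * norm (\<Sum>i\<in>I. w i)
      = norm ((\<Sum>i\<in>I. c i *\<^sub>R w i) + (\<Sum>i\<in>I. (M - c i) *\<^sub>R w i))"
    using M by (metis abs_of_nonneg norm_scaleR)
  also have "\<dots> \<le> norm (\<Sum>i\<in>I. c i *\<^sub>R w i) + (\<Sum>i\<in>I. M - c i)"
    using w c by (intro norm_triangle_mono order_refl sum_norm_le) simp
  finally have "M * norm (\<Sum>i\<in>I. w i) + (\<Sum>i\<in>I. c i) - M * card I \<le> norm (\<Sum>i\<in>I. c i *\<^sub>R w i)"
    by (simp add: sum_subtractf mult.commute)
  moreover have "M * (real (card I) - e) \<le> M * norm (\<Sum>i\<in>I. w i)"
    using sum M by (rule mult_left_mono)
  ultimately show ?thesis by (simp add: right_diff_distrib)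
qed

lemma ex_large_sum_of_aligned:
  fixes w v :: "nat \<Rightarrow> 'a::real_normed_vector"
  assumes u: "norm u = 1" and w: "\<And>n. norm (w n) = 1"
    and aligned: "\<And>n. real n + 1 - e \<le> norm (u + (\<Sum>i<n. w i))"
    and s: "s \<in> closure (convex hull (range v))" and s_eq: "s = norm s *\<^sub>R u" and e: "0 < e"
  shows "\<exists>i. 1 + norm s - (2 + norm s) * e \<le> norm (w i + v i)"
proof -
  obtain t where t: "t \<in> convex hull (range v)" "dist t s < e"
    using s e by (auto simp: closure_approachable)
  then obtain n c where c: "\<And>i. 0 \<le> c i" "\<And>i. c i \<le> 1" "sum c {..<n} = 1"
    and t_eq: "t = (\<Sum>i<n. c i *\<^sub>R v i)"
    using convex_hull_range_coeffs by metis
  \<comment> \<open>Index 0 carries s as norm s times u, and the w are shifted by one. The weights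
    sum to 1 + norm s, which also bounds each of them.\<close>
  define w' where "w' i = (case i of 0 \<Rightarrow> u | Suc j \<Rightarrow> w j)" for i
  define c' where "c' i = (case i of 0 \<Rightarrow> norm s | Suc j \<Rightarrow> c j)" for i
  have "(\<Sum>i<Suc n. c' i) - (1 + norm s) * e \<le> norm (\<Sum>i<Suc n. c' i *\<^sub>R w' i)"
  proof (rule norm_aligned_combination)
    show "norm (w' i) = 1" for i using u w by (simp add: w'_def split: nat.split)
    show "c' i \<le> 1 + norm s" for i
      using c(2) by (auto simp: c'_def split: nat.split intro: add_increasing2)
    show "real (card {..<Suc n}) - e \<le> norm (\<Sum>i<Suc n. w' i)"
      using aligned[of n] by (simp add: w'_def sum.lessThan_Suc_shift del: sum.lessThan_Suc)
  qed simp
  then have "1 + norm s - (1 + norm s) * e \<le> norm (s + (\<Sum>i<n. c i *\<^sub>R w i))"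
    using c(3) s_eq by (simp add: w'_def c'_def sum.lessThan_Suc_shift add.commute del: sum.lessThan_Suc)
  \<comment> \<open>Trading s for t costs e, which raises the loss from (1 + norm s) e to (2 + norm
    s) e.\<close>
  also have "s + (\<Sum>i<n. c i *\<^sub>R w i) = (s - t) + (\<Sum>i<n. c i *\<^sub>R (w i + v i))"
    by (simp add: t_eq scaleR_add_right sum.distrib)
  also have "norm \<dots> \<le> e + (\<Sum>i<n. c i * norm (w i + v i))"
    using t(2) c(1) by (intro norm_triangle_mono sum_norm_le) (auto simp: dist_norm norm_minus_commute)
  finally have *: "1 + norm s - (2 + norm s) * e \<le> (\<Sum>i<n. c i * norm (w i + v i))"
    by (simp add: algebra_simps)
  show ?thesis
  \<comment> \<open>The sum is a convex average of the norms, so they cannot all lie below the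
    bound.\<close>
  proof (rule ccontr)
    assume "\<not> ?thesis"
    then have less: "norm (w i + v i) < 1 + norm s - (2 + norm s) * e" for i
      by (simp add: not_le)
    have "(\<Sum>i<n. c i * norm (w i + v i)) < (\<Sum>i<n. c i * (1 + norm s - (2 + norm s) * e))"
    proof (rule sum_strict_mono_ex1)
      show "\<forall>i\<in>{..<n}. c i * norm (w i + v i) \<le> c i * (1 + norm s - (2 + norm s) * e)"
        by (intro ballI mult_left_mono less_imp_le[OF less] c(1))
      obtain i where "i < n" "c i \<noteq> 0"
        using c(3) by (metis lessThan_iff sum.neutral zero_neq_one)
      then show "\<exists>i\<in>{..<n}. c i * norm (w i + v i) < c i * (1 + norm s - (2 + norm s) * e)"
        using less c(1)[of i] by (intro bexI[of _ i]) auto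
    qed simp
    also have "\<dots> = 1 + norm s - (2 + norm s) * e"
      using c(3) by (simp flip: sum_distrib_right)
    finally show False using * by simp
  qed
qed

context normed_space_real_parts
begin

lemma lip_norm_id_plus_approx:
  assumes aDP: "alternative_Daugavet_property smul" and T: "T \<in> Lip"
    and SCD: "SCD_set smul (slope T)" and s: "s \<in> slope T" and e: "0 < e" "e \<le> 1"
  obtains \<theta> where "norm \<theta> = 1"
    "1 + norm s - (2 + norm s) * e \<le> lip_norm (\<lambda>x. x + smul \<theta> (T x))"
proof -
  obtain S where S: "\<And>n::nat. is_slice smul (slope T) (S n)"
    and det: "\<And>B. B \<subseteq> slope T \<Longrightarrow> (\<And>n. B \<inter> S n \<noteq> {}) \<Longrightarrow> slope T \<subseteq> closure (convex hull B)"
    using SCD unfolding SCD_set_def by metis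
  obtain a b :: 'a where "a \<noteq> b" using s by (auto simp: slope_def)
  then have "norm (sgn (a - b)) = 1" by (simp add: norm_sgn)
  \<comment> \<open>For s = 0 any unit vector serves; one exists because a slope involves two
    distinct points.\<close>
  then have "\<exists>u. norm u = 1 \<and> s = norm s *\<^sub>R u"
  proof (cases "s = 0")
    case False
    then have "norm (sgn s) = 1 \<and> s = norm s *\<^sub>R sgn s"
      by (simp add: norm_sgn) (simp add: sgn_div_norm)
    then show ?thesis by blast
  qed auto
  then obtain u where u: "norm u = 1" "s = norm s *\<^sub>R u" by blast
  obtain x1 x2 :: "nat \<Rightarrow> 'a" and \<theta> :: "nat \<Rightarrow> 'k" where x: "\<And>n. x1 n \<noteq> x2 n"
    and \<theta>: "\<And>n. norm (\<theta> n) = 1"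
    and inS: "\<And>n. (T (x1 n) - T (x2 n)) /\<^sub>R norm (x1 n - x2 n) \<in> S n"
    and aligned: "\<And>n. real n + 1 - e \<le>
       norm (u + (\<Sum>i<n. smul (\<theta> i) ((x1 i - x2 i) /\<^sub>R norm (x1 i - x2 i))))"
    by (rule aligned_sequence[where S = S, OF aDP T _ u(1) e]) (rule S, rule that)
  define v where "v n = (T (x1 n) - T (x2 n)) /\<^sub>R norm (x1 n - x2 n)" for n
  define w where "w n = smul (\<theta> n) ((x1 n - x2 n) /\<^sub>R norm (x1 n - x2 n))" for n
  have "slope T \<subseteq> closure (convex hull (range v))"
  proof (rule det)
    show "range v \<subseteq> slope T" using x by (auto simp: v_def slope_def)
    show "range v \<inter> S n \<noteq> {}" for n using inS[of n] by (auto simp: v_def)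
  qed
  with s have "s \<in> closure (convex hull (range v))" by blast
  moreover have "norm (w n) = 1" for n using x \<theta> by (simp add: w_def norm_smul)
  ultimately obtain i where i: "1 + norm s - (2 + norm s) * e \<le> norm (w i + v i)"
    using ex_large_sum_of_aligned[of u w e s v] u aligned e by (auto simp: w_def)
  \<comment> \<open>The rotation of the direction is undone and passes to T as its inverse: up to a
    unimodular factor, w + v is a slope of Id + \<phi> T.\<close>
  define \<phi> where "\<phi> = 1 / \<theta> i"
  have \<phi>: "norm \<phi> = 1" "\<theta> i * \<phi> = 1"
    using \<theta>[of i] by (auto simp: \<phi>_def norm_divide simp flip: norm_le_zero_iff)
  have "w i + v i = smul (\<theta> i) ((x1 i + smul \<phi> (T (x1 i)) - (x2 i + smul \<phi> (T (x2 i))))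
      /\<^sub>R norm (x1 i - x2 i))"
    using \<phi> by (simp add: w_def v_def smul_scaleR scale_right_distrib scale_right_diff_distrib algebra_simps)
  then have "norm (w i + v i) = norm ((x1 i + smul \<phi> (T (x1 i)) - (x2 i + smul \<phi> (T (x2 i))))
      /\<^sub>R norm (x1 i - x2 i))"
    using \<theta> by (simp only: norm_smul mult_1)
  also have "\<dots> \<le> lip_norm (\<lambda>x. x + smul \<phi> (T x))"
    using lip_norm_ge[OF id_plus_smul_Lip[OF T] x] .
  finally show ?thesis using that[of \<phi>] \<phi> i by simp
qed

theorem SCD_slope_imp_alternative_Daugavet_equation:
  assumes aDP: "alternative_Daugavet_property smul" and T: "T \<in> Lip"
    and SCD: "SCD_set smul (slope T)"
  shows "alternative_Daugavet_equation smul T"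
proof -
  \<comment> \<open>Slices are nonempty by definition, so the space has two distinct points.\<close>
  have "slope T \<noteq> {}" using SCD by (auto simp: SCD_set_def is_slice_def)
  then obtain a b :: 'a where ab: "a \<noteq> b" by (auto simp: slope_def)
  define m where "m = lip_norm T"
  have m: "0 \<le> m"
    using lip_norm_ge[OF T ab] norm_ge_zero order_trans unfolding m_def by blast
  show ?thesis
  proof (rule alternative_Daugavet_equationI[OF T ab])
    fix e :: real assume e: "0 < e"
    \<comment> \<open>The approximation loses (2 + norm s) d and the choice of s another d, in all
      at most (3 + m) d.\<close>
    define d where "d = min 1 (e / (3 + m))"
    have d: "0 < d" "d \<le> 1" and "d \<le> e / (3 + m)"
      using e m by (auto simp: d_def)
    then have d_le: "d * (3 + m) \<le> e"
      using m by (simp add: pos_le_divide_eq)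
    have "m - d < lip_norm T" using d by (simp add: m_def)
    then obtain s where s: "s \<in> slope T" "m - d < norm s"
      using ex_slope_norm_gt[OF ab] by blast
    have "norm s \<le> m"
      using s(1) lip_norm_ge[OF T] by (auto simp: slope_def m_def)
    then have "(2 + norm s) * d \<le> (2 + m) * d" using d by simp
    moreover obtain \<theta> where "norm \<theta> = 1"
      "1 + norm s - (2 + norm s) * d \<le> lip_norm (\<lambda>x. x + smul \<theta> (T x))"
      using lip_norm_id_plus_approx[OF aDP T SCD s(1) d(1,2)] .
    ultimately show "\<exists>\<theta>. norm \<theta> = 1 \<and> 1 + lip_norm T - e \<le> lip_norm (\<lambda>x. x + smul \<theta> (T x))"
      using s(2) d_le by (intro exI[of _ \<theta>]) (simp add: m_def algebra_simps)
  qed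
qed

end

theorem theorem3p7:
  "(alternative_Daugavet_property (scaleR :: real \<Rightarrow> 'a::banach \<Rightarrow> 'a) \<longrightarrow>
      (\<forall>T \<in> Lip. SCD_set (scaleR :: real \<Rightarrow> 'a \<Rightarrow> 'a) (slope T) \<longrightarrow>
         alternative_Daugavet_equation (scaleR :: real \<Rightarrow> 'a \<Rightarrow> 'a) T))
   \<and>
   (\<forall>scaleC :: complex \<Rightarrow> 'b::banach \<Rightarrow> 'b.
      normed_space_over scaleC \<longrightarrow> alternative_Daugavet_property scaleC \<longrightarrow>
      (\<forall>T \<in> Lip. SCD_set scaleC (slope T) \<longrightarrow> alternative_Daugavet_equation scaleC T))"
  using normed_space_real_parts.SCD_slope_imp_alternative_Daugavet_equation
      [OF normed_space_real_parts_scaleR]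
    normed_space_real_parts.SCD_slope_imp_alternative_Daugavet_equation
      [OF normed_space_real_parts_complex]
  by blast

end
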